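(* Let $\mathcal{G}$ be a connected simple weighted graph with $n$ nodes and $m$ edges, with incidence matrix $C$, positive diagonal matrices $M$ (inertias) and $B$ (susceptances), and damping matrix $D=\gamma M$ with $\gamma>0$. Let $L=M^{-1/2}CBC^TM^{-1/2}$ have eigenvalues $0=\lambda_1<\lambda_2\le\cdots\le\lambda_n$ with corresponding orthonormal eigenvectors $v_1,\dots,v_n$. Consider the system, with state $x=[\omega;P]\in\mathbb{R}^{n+m}$, $$\dot x=\begin{bmatrix}-M^{-1}D & -M^{-1}C\\ BC^T & 0\end{bmatrix}x+\begin{bmatrix}M^{-1}\\0\end{bmatrix}s,$$ where the input $s\in\mathbb{R}^n$ is constant in time, and write $s=\sum_{i=1}^n\hat s_iM^{1/2}v_i$. Assume that $x(0)=0$ and that $\gamma^2-4\lambda_i\ne0$ for all $i$. Then for all $t\ge 0$ $$\omega(t)=\sum_{i=1}^n\frac{\hat s_i}{\sqrt{\gamma^2-4\lambda_i}}\left(e^{\phi_{i,+}t}-e^{\phi_{i,-}t}\right)M^{-1/2}v_i,$$ where $$\phi_{i,+}=\frac{-\gamma+\sqrt{\gamma^2-4\lambda_i}}{2},\qquad \phi_{i,-}=\frac{-\gamma-\sqrt{\gamma^2-4\lambda_i}}{2}.$$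
   Context: $\mathcal{G}=(\mathcal{N},\mathcal{E})$ with $\mathcal{N}=\{1,\dots,n\}$ is a connected simple graph with $|\mathcal{E}|=m$ edges, each given an arbitrary orientation. The incidence matrix $C\in\mathbb{R}^{n\times m}$ has $C_{je}=1$ if node $j$ is the source of $e$, $C_{je}=-1$ if $j$ is the target of $e$, and $0$ otherwise. $B$ is the $m\times m$ diagonal matrix of edge weights $B_{ij}>0$ (line susceptances); $M$ and $D$ are $n\times n$ diagonal matrices with entries $M_j>0$ and $D_j$, where the ratio $D_j/M_j=\gamma>0$ does not depend on $j$. $[a;b]$ denotes stacking $a$ on top of $b$ in a column. $\omega(t)\in\mathbb{R}^n$ is the vector of node frequency deviations and $P(t)\in\mathbb{R}^m$ the vector of branch flow deviations. Square roots of negative numbers are purely imaginary, with the same square root used consistently for each $i$. *)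

theory Defs
  imports Complex_Main "Jordan_Normal_Form.Char_Poly"
begin

text \<open>Vectors and matrices of the Jordan-Normal-Form library are indexed from 0, so the nodes are
  \<open>0, \<dots>, n - 1\<close>, the branches \<open>0, \<dots>, m - 1\<close> and the modes \<open>0, \<dots>, n - 1\<close>.
  Their dimensions may be 0, which admits the one-node graph (\<open>n = 1\<close>, \<open>m = 0\<close>).\<close>

definition simple_graph :: "nat set \<Rightarrow> nat set set \<Rightarrow> bool" where
  "simple_graph V E \<longleftrightarrow> finite V \<and> (\<forall>e\<in>E. e \<subseteq> V \<and> card e = 2)"

definition connected_graph :: "nat set \<Rightarrow> nat set set \<Rightarrow> bool" where
  "connected_graph V E \<longleftrightarrow> V \<noteq> {} \<and> (\<forall>u\<in>V. \<forall>w\<in>V. (u, w) \<in> {(a, b). {a, b} \<in> E}\<^sup>*)"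

text \<open>An arbitrary numbering of the edges together with an arbitrary orientation
  \<open>src k \<rightarrow> tgt k\<close> of each of them.  The bijection forces \<open>card E = m\<close>, and
  \<open>src k \<noteq> tgt k\<close> in a simple graph.\<close>

definition oriented_enumeration ::
  "nat set set \<Rightarrow> nat \<Rightarrow> (nat \<Rightarrow> nat) \<Rightarrow> (nat \<Rightarrow> nat) \<Rightarrow> bool" where
  "oriented_enumeration E m src tgt \<longleftrightarrow> bij_betw (\<lambda>k. {src k, tgt k}) {0..<m} E"

definition incidence_mat :: "nat \<Rightarrow> nat \<Rightarrow> (nat \<Rightarrow> nat) \<Rightarrow> (nat \<Rightarrow> nat) \<Rightarrow> real mat" where
  "incidence_mat n m src tgt =
     mat n m (\<lambda>(j, k). if j = src k then 1 else if j = tgt k then - 1 else 0)"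

text \<open>\<open>x' = A x + F s\<close> on \<open>[0, \<infinity>)\<close> with constant input \<open>s\<close>, read componentwise
  (one-sided derivative at 0).\<close>

definition solves_lti :: "real mat \<Rightarrow> real mat \<Rightarrow> real vec \<Rightarrow> (real \<Rightarrow> real vec) \<Rightarrow> bool" where
  "solves_lti A F s x \<longleftrightarrow>
     (\<forall>t\<ge>0. x t \<in> carrier_vec (dim_row A) \<and>
        (\<forall>k<dim_row A. ((\<lambda>\<tau>. x \<tau> $ k) has_real_derivative (A *\<^sub>v x t + F *\<^sub>v s) $ k)
                          (at t within {0..})))"

end

(* Projecting the frequencies on the eigenvectors of L decouples the system: for
   y = v_i . M^(1/2) omega and q = shat_i - v_i . M^(-1/2) C P one gets y' = -gamma y + q and
   q' = -lambda_i y.  For either root phi of phi^2 + gamma phi + lambda_i = 0 the combination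
   q + phi y then satisfies u' = phi u, so it equals shat_i exp (phi t); subtracting the two
   combinations yields y, and completeness of the eigenbasis recovers omega. *)

theory Submission
  imports Defs
begin

text \<open>The mean value theorem needs continuity on \<open>{0..t}\<close> but a two-sided
  derivative only in the interior, so the one-sided derivative at 0 is no obstacle. It concerns real
  functions, hence the passage to real and imaginary parts.\<close>

lemma vector_derivative_zero_imp_constant_nonneg:
  fixes f :: "real \<Rightarrow> complex"
  assumes f: "\<And>t. t \<ge> 0 \<Longrightarrow> (f has_vector_derivative 0) (at t within {0..})"
    and t: "t \<ge> 0"
  shows "f t = f 0"
proof (cases "t = 0")
  case False
  have const: "g t = g 0"
    if g: "\<And>u. u \<ge> 0 \<Longrightarrow> (g has_real_derivative 0) (at u within {0..})"
    for g :: "real \<Rightarrow> real"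
  proof (rule DERIV_isconst2[of 0 t])
    show "continuous_on {0..t} g"
      by (rule DERIV_continuous_on[where D = "\<lambda>_. 0"]) (rule DERIV_subset[OF g], auto)
    show "(g has_real_derivative 0) (at u)" if "0 < u" "u < t" for u
    proof -
      \<comment> \<open>An interior point lies in the open half-line, and within an open set the
        derivative is the ordinary two-sided one.\<close>
      have "(g has_real_derivative 0) (at u within {0<..})"
        using g[of u] that by (auto intro: DERIV_subset)
      then show ?thesis
        using that by (simp add: at_within_open[of u "{0<..}"])
    qed
  qed (use t False in auto)
  show ?thesis
  proof (rule complex_eqI)
    show "Re (f t) = Re (f 0)"
      using bounded_linear.has_vector_derivative[OF bounded_linear_Re f]
      by (intro const) (simp add: has_real_derivative_iff_has_vector_derivative)
    show "Im (f t) = Im (f 0)"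
      using bounded_linear.has_vector_derivative[OF bounded_linear_Im f]
      by (intro const) (simp add: has_real_derivative_iff_has_vector_derivative)
  qed
qed simp

text \<open>Integrating factor: the product of \<open>u\<close> with
  \<open>exp (- \<phi> * of_real t)\<close> has derivative zero, so it keeps its value at 0.\<close>

lemma linear_ode_unique_exp:
  fixes u :: "real \<Rightarrow> complex"
  assumes u: "\<And>t. t \<ge> 0 \<Longrightarrow> (u has_vector_derivative \<phi> * u t) (at t within {0..})"
    and t: "t \<ge> 0"
  shows "u t = u 0 * exp (\<phi> * of_real t)"
proof -
  have "((\<lambda>t. u t * exp (- \<phi> * of_real t)) has_vector_derivative 0) (at t within {0..})"
    if "t \<ge> 0" for t
  proof -
    have "((\<lambda>z. exp (- \<phi> * z)) has_field_derivative exp (- \<phi> * of_real t) * (- \<phi>))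
            (at (of_real t))"
      by (auto intro!: derivative_eq_intros)
    then have "((\<lambda>t. exp (- \<phi> * of_real t)) has_vector_derivative
            exp (- \<phi> * of_real t) * (- \<phi>)) (at t within {0..})"
      by (rule has_vector_derivative_real_field)
    from has_vector_derivative_mult[OF u[OF that] this]
    show ?thesis by (simp add: algebra_simps)
  qed
  from vector_derivative_zero_imp_constant_nonneg[of "\<lambda>t. u t * exp (- \<phi> * of_real t)", OF this t]
  have "u t * exp (- \<phi> * of_real t) = u 0" by simp
  then show ?thesis
    by (simp add: exp_minus field_simps)
qed

text \<open>The response of a single mode, with \<open>\<mu>\<close> standing for its eigenvalue.
  Letting \<open>r\<close> be either complex square root of the discriminant treats oscillating and
  overdamped modes alike; \<open>r \<noteq> 0\<close> keeps the two characteristic roots distinct,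
  so that \<open>y\<close> can be recovered from the two exponentials.\<close>

lemma damped_oscillator_response:
  fixes y q :: "real \<Rightarrow> real" and r :: complex
  assumes y: "\<And>t. t \<ge> 0 \<Longrightarrow> (y has_real_derivative - \<gamma> * y t + q t) (at t within {0..})"
    and q: "\<And>t. t \<ge> 0 \<Longrightarrow> (q has_real_derivative - \<mu> * y t) (at t within {0..})"
    and y0: "y 0 = 0"
    and r: "r\<^sup>2 = of_real (\<gamma>\<^sup>2 - 4 * \<mu>)" and r0: "r \<noteq> 0" and t: "t \<ge> 0"
  shows "of_real (y t) = of_real (q 0) / r *
    (exp ((- of_real \<gamma> + r) / 2 * of_real t) - exp ((- of_real \<gamma> - r) / 2 * of_real t))"
proof -
  \<comment> \<open>The row \<open>(\<phi>, 1)\<close> is a left eigenvector, with eigenvalue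
    \<open>\<phi>\<close>, of the coefficient matrix of the system in \<open>(y, q)\<close> exactly
    when \<open>\<phi>\<close> solves the characteristic equation. Since \<open>y 0 = 0\<close>, the
    amplitude is \<open>q 0\<close> for both roots.\<close>
  have mode: "of_real (q t) + \<phi> * of_real (y t) = of_real (q 0) * exp (\<phi> * of_real t)"
    if \<phi>: "\<phi>\<^sup>2 = - of_real \<mu> - of_real \<gamma> * \<phi>" for \<phi> :: complex
  proof -
    have "((\<lambda>t. of_real (q t) + \<phi> * of_real (y t)) has_vector_derivative
             \<phi> * (of_real (q t) + \<phi> * of_real (y t))) (at t within {0..})"
      if "t \<ge> 0" for t
    proof -
      have "((\<lambda>t. of_real (q t) + \<phi> * of_real (y t)) has_vector_derivative
             of_real (- \<mu> * y t) + \<phi> * of_real (- \<gamma> * y t + q t)) (at t within {0..})"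
        using y[OF that] q[OF that]
        by (intro has_vector_derivative_add has_vector_derivative_mult_right
              has_vector_derivative_of_real)
           (simp_all add: has_real_derivative_iff_has_vector_derivative)
      also have "of_real (- \<mu> * y t) + \<phi> * of_real (- \<gamma> * y t + q t)
          = \<phi> * of_real (q t) + (- of_real \<mu> - of_real \<gamma> * \<phi>) * of_real (y t)"
        by (simp add: algebra_simps)
      also have "\<dots> = \<phi> * (of_real (q t) + \<phi> * of_real (y t))"
        unfolding \<phi>[symmetric] by (simp add: power2_eq_square algebra_simps)
      finally show ?thesis .
    qed
    from linear_ode_unique_exp[of "\<lambda>t. of_real (q t) + \<phi> * of_real (y t)", OF this t]
    show ?thesis by (simp add: y0)
  qed
  \<comment> \<open>Eliminating \<open>\<mu>\<close> in favour of \<open>r\<close> reduces both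
    characteristic equations to polynomial identities in \<open>\<gamma>\<close> and
    \<open>r\<close>.\<close>
  have \<mu>: "complex_of_real \<mu> = ((of_real \<gamma>)\<^sup>2 - r\<^sup>2) / 4"
    using r by simp
  have "((- of_real \<gamma> + r) / 2)\<^sup>2 = - of_real \<mu> - of_real \<gamma> * ((- of_real \<gamma> + r) / 2)"
    "((- of_real \<gamma> - r) / 2)\<^sup>2 = - of_real \<mu> - of_real \<gamma> * ((- of_real \<gamma> - r) / 2)"
    unfolding \<mu> by (simp_all add: power2_eq_square field_simps)
  note modes = this[THEN mode]
  \<comment> \<open>In the difference \<open>q\<close> cancels, and the two roots differ by
    \<open>r\<close>.\<close>
  have "r * of_real (y t)
      = (of_real (q t) + (- of_real \<gamma> + r) / 2 * of_real (y t))
        - (of_real (q t) + (- of_real \<gamma> - r) / 2 * of_real (y t))"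
    by (simp add: field_simps)
  also have "\<dots> = of_real (q 0) *
    (exp ((- of_real \<gamma> + r) / 2 * of_real t) - exp ((- of_real \<gamma> - r) / 2 * of_real t))"
    unfolding modes by (simp only: right_diff_distrib)
  finally show ?thesis
    using r0 by (simp add: field_simps)
qed

text \<open>With the vectors as rows of a square matrix \<open>V\<close>, orthonormality says that
  the transpose is a right inverse of \<open>V\<close>. For square matrices it is then also a left
  inverse, and the sums here are the entries of that second product.\<close>

lemma orthonormal_complete:
  fixes v :: "nat \<Rightarrow> real vec"
  assumes carrier: "\<And>i. i < n \<Longrightarrow> v i \<in> carrier_vec n"
    and orthonormal: "\<And>i j. i < n \<Longrightarrow> j < n \<Longrightarrow> v i \<bullet> v j = (if i = j then 1 else 0)"
    and jk: "j < n" "k < n"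
  shows "(\<Sum>i<n. v i $ j * v i $ k) = (if j = k then 1 else 0)"
proof -
  define V where "V = mat n n (\<lambda>(i, j). v i $ j)"
  have V: "V \<in> carrier_mat n n" by (simp add: V_def)
  have "V * transpose_mat V = 1\<^sub>m n"
  proof (rule eq_matI)
    fix i l assume "i < dim_row (1\<^sub>m n :: real mat)" "l < dim_col (1\<^sub>m n :: real mat)"
    then show "(V * transpose_mat V) $$ (i, l) = 1\<^sub>m n $$ (i, l)"
      using orthonormal[of i l] carrier[of i] carrier[of l]
      by (simp add: V_def scalar_prod_def)
  qed (simp_all add: V_def)
  then have "transpose_mat V * V = 1\<^sub>m n"
    using mat_mult_left_right_inverse[OF V, of "transpose_mat V"] V by simp
  then have "(transpose_mat V * V) $$ (j, k) = (1\<^sub>m n :: real mat) $$ (j, k)"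
    by simp
  then show ?thesis
    using jk by (simp add: V_def scalar_prod_def atLeast0LessThan)
qed

lemma mat_diag_mult_vec:
  fixes f :: "nat \<Rightarrow> 'a :: semiring_0"
  assumes "u \<in> carrier_vec n"
  shows "mat_diag n f *\<^sub>v u = vec n (\<lambda>j. f j * u $ j)"
proof (rule eq_vecI)
  fix j assume "j < dim_vec (vec n (\<lambda>j. f j * u $ j))"
  then show "(mat_diag n f *\<^sub>v u) $ j = vec n (\<lambda>j. f j * u $ j) $ j"
    using assms by (simp add: mat_diag_def scalar_prod_def if_distribR if_distrib[of "\<lambda>z. z * _"] cong: if_cong)
qed (simp add: mat_diag_def)

text \<open>Extracts scalar differential equations from the system. \<open>g\<close> has to match
  the coordinate at nonnegative times only, because the splitting of the state into frequencies and
  flows is known only there; a derivative within \<open>{0..}\<close> does not see other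
  times.\<close>

lemma solves_lti_derivative:
  assumes "solves_lti A F s x" "t \<ge> 0" "k < dim_row A"
    and "\<And>\<tau>. \<tau> \<ge> 0 \<Longrightarrow> x \<tau> $ k = g \<tau>" and "(A *\<^sub>v x t + F *\<^sub>v s) $ k = d"
  shows "(g has_real_derivative d) (at t within {0..})"
proof (rule has_field_derivative_transform_within[where d = 1])
  show "((\<lambda>\<tau>. x \<tau> $ k) has_real_derivative d) (at t within {0..})"
    using assms unfolding solves_lti_def by auto
qed (use assms in auto)

theorem mainTheorem2:
  fixes n m :: nat and E :: "nat set set" and src tgt :: "nat \<Rightarrow> nat"
    and inertia damping suscept :: "nat \<Rightarrow> real" and \<gamma> :: real
    and C B M D Minv Msqrt Minvsqrt L :: "real mat"
    and lam :: "nat \<Rightarrow> real" and v :: "nat \<Rightarrow> real vec"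
    and s :: "real vec" and shat :: "nat \<Rightarrow> real"
    and \<omega> P x :: "real \<Rightarrow> real vec"
    and r \<phi>p \<phi>m :: "nat \<Rightarrow> complex"
  assumes graph: "simple_graph {0..<n} E" "connected_graph {0..<n} E"
    and orientation: "oriented_enumeration E m src tgt"
    and C: "C = incidence_mat n m src tgt"
    and B: "B = mat_diag m suscept" and B_pos: "\<And>k. k < m \<Longrightarrow> suscept k > 0"
    and M: "M = mat_diag n inertia" and M_pos: "\<And>j. j < n \<Longrightarrow> inertia j > 0"
    and D: "D = mat_diag n damping" and D_eq: "D = \<gamma> \<cdot>\<^sub>m M" and \<gamma>_pos: "\<gamma> > 0"
    and Minv: "Minv = mat_diag n (\<lambda>j. 1 / inertia j)"
    and Msqrt: "Msqrt = mat_diag n (\<lambda>j. sqrt (inertia j))"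
    and Minvsqrt: "Minvsqrt = mat_diag n (\<lambda>j. 1 / sqrt (inertia j))"
    and L: "L = Minvsqrt * C * B * transpose_mat C * Minvsqrt"
    and eigen: "\<And>i. i < n \<Longrightarrow> eigenvector L (v i) (lam i)"
    and orthonormal: "\<And>i j. i < n \<Longrightarrow> j < n \<Longrightarrow> v i \<bullet> v j = (if i = j then 1 else 0)"
    and lam_0: "lam 0 = 0" and lam_1: "1 < n \<Longrightarrow> 0 < lam 1"
    and lam_mono: "\<And>i j. i \<le> j \<Longrightarrow> j < n \<Longrightarrow> lam i \<le> lam j"
    and s: "s \<in> carrier_vec n"
    and s_expansion: "s = vec n (\<lambda>j. \<Sum>i<n. shat i * (Msqrt *\<^sub>v v i) $ j)"
    and dims: "\<And>t. t \<ge> 0 \<Longrightarrow> \<omega> t \<in> carrier_vec n" "\<And>t. t \<ge> 0 \<Longrightarrow> P t \<in> carrier_vec m"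
    and x: "\<And>t. t \<ge> 0 \<Longrightarrow> x t = \<omega> t @\<^sub>v P t"
    and dynamics: "solves_lti
           (four_block_mat (- (Minv * D)) (- (Minv * C)) (B * transpose_mat C) (0\<^sub>m m m))
           (Minv @\<^sub>r 0\<^sub>m m n) s x"
    and initial: "x 0 = 0\<^sub>v (n + m)"
    and nondegenerate: "\<And>i. i < n \<Longrightarrow> \<gamma>\<^sup>2 - 4 * lam i \<noteq> 0"
    and root: "\<And>i. i < n \<Longrightarrow> (r i)\<^sup>2 = complex_of_real (\<gamma>\<^sup>2 - 4 * lam i)"
    and \<phi>p: "\<And>i. i < n \<Longrightarrow> \<phi>p i = (- complex_of_real \<gamma> + r i) / 2"
    and \<phi>m: "\<And>i. i < n \<Longrightarrow> \<phi>m i = (- complex_of_real \<gamma> - r i) / 2"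
  shows "\<forall>t\<ge>0. map_vec complex_of_real (\<omega> t) =
    vec n (\<lambda>j. \<Sum>i<n. complex_of_real (shat i) / r i
                     * (exp (\<phi>p i * complex_of_real t) - exp (\<phi>m i * complex_of_real t))
                     * complex_of_real ((Minvsqrt *\<^sub>v v i) $ j))"
proof (intro allI impI)
  fix t :: real assume t: "t \<ge> 0"
  let ?A = "four_block_mat (- (Minv * D)) (- (Minv * C)) (B * transpose_mat C) (0\<^sub>m m m)"
  let ?F = "Minv @\<^sub>r 0\<^sub>m m n"
  define c where "c j k = C $$ (j, k)" for j k
  have carr: "C \<in> carrier_mat n m" "B \<in> carrier_mat m m" "Minv \<in> carrier_mat n n"
    "D \<in> carrier_mat n n" "Minvsqrt \<in> carrier_mat n n"
    by (simp_all add: C B Minv D Minvsqrt incidence_mat_def)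
  note [simp] = carr carr[THEN carrier_matD(1)] carr[THEN carrier_matD(2)]
  have [simp]: "C *\<^sub>v u \<in> carrier_vec n" "transpose_mat C *\<^sub>v u \<in> carrier_vec m" for u
    by (simp_all add: carrier_vecI)
  have v [simp]: "v i \<in> carrier_vec n" if "i < n" for i
    using eigen[OF that] by (simp add: eigenvector_def L)
  note [simp] = v[THEN carrier_vecD] dims dims[THEN carrier_vecD]
  have sqrt_pos: "sqrt (inertia j) > 0" if "j < n" for j
    using M_pos[OF that] by simp
  have C_mult: "(C *\<^sub>v u) $ j = (\<Sum>k<m. c j k * u $ k)" if "u \<in> carrier_vec m" "j < n" for u j
    using that by (simp add: scalar_prod_def c_def atLeast0LessThan)
  have Ct_mult: "(transpose_mat C *\<^sub>v u) $ k = (\<Sum>j<n. c j k * u $ j)"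
    if "u \<in> carrier_vec n" "k < m" for u k
    using that by (simp add: scalar_prod_def c_def atLeast0LessThan)

  \<comment> \<open>The dynamics in block form and in components\<close>
  have rhs: "?A *\<^sub>v x \<tau> + ?F *\<^sub>v s
      = (Minv *\<^sub>v s - \<gamma> \<cdot>\<^sub>v \<omega> \<tau> - Minv *\<^sub>v (C *\<^sub>v P \<tau>)) @\<^sub>v
        (B *\<^sub>v (transpose_mat C *\<^sub>v \<omega> \<tau>))" if \<tau>: "\<tau> \<ge> 0" for \<tau>
  proof -
    note [simp] = \<tau>
    \<comment> \<open>Proportional damping makes \<open>Minv * D\<close> equal to
      \<open>\<gamma>\<close> times the identity: all nodes are damped at the same rate, so damping
      does not couple the modes.\<close>
    have "D = mat_diag n (\<lambda>j. \<gamma> * inertia j)"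
      unfolding D_eq M by (intro eq_matI) (auto simp: mat_diag_def)
    then have "Minv * D = mat_diag n (\<lambda>j. 1 / inertia j * (\<gamma> * inertia j))"
      unfolding Minv by simp
    also have "\<dots> = mat_diag n (\<lambda>_. \<gamma>)"
      by (intro eq_matI) (auto simp: mat_diag_def dest: M_pos)
    finally have "Minv * D *\<^sub>v \<omega> \<tau> = \<gamma> \<cdot>\<^sub>v \<omega> \<tau>"
      by (simp add: mat_diag_mult_vec) (intro eq_vecI, auto)
    then have "- (Minv * D) *\<^sub>v \<omega> \<tau> = - (\<gamma> \<cdot>\<^sub>v \<omega> \<tau>)"
      by simp
    moreover have "- (Minv * C) *\<^sub>v P \<tau> = - (Minv *\<^sub>v (C *\<^sub>v P \<tau>))"
      by (simp add: assoc_mult_mat_vec[of _ n n _ m])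
    moreover have "?A *\<^sub>v x \<tau> =
        (- (Minv * D) *\<^sub>v \<omega> \<tau> + - (Minv * C) *\<^sub>v P \<tau>) @\<^sub>v
        ((B * transpose_mat C) *\<^sub>v \<omega> \<tau> + 0\<^sub>m m m *\<^sub>v P \<tau>)"
      unfolding x[OF \<tau>] by (intro four_block_mat_mult_vec) auto
    moreover have "?F *\<^sub>v s = (Minv *\<^sub>v s) @\<^sub>v (0\<^sub>m m n *\<^sub>v s)"
      using s by (intro mat_mult_append) auto
    moreover have "(B * transpose_mat C) *\<^sub>v \<omega> \<tau> = B *\<^sub>v (transpose_mat C *\<^sub>v \<omega> \<tau>)"
      by (simp add: assoc_mult_mat_vec[of _ m m _ n])
    ultimately show ?thesis
      using s by (intro eq_vecI) auto
  qed
  have d\<omega>: "((\<lambda>\<tau>. \<omega> \<tau> $ j) has_real_derivative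
      - \<gamma> * \<omega> t $ j - (\<Sum>k<m. c j k * P t $ k) / inertia j + s $ j / inertia j)
      (at t within {0..})" if t: "t \<ge> 0" and j: "j < n" for t j
  proof (rule solves_lti_derivative[OF dynamics t, of j])
    show "(?A *\<^sub>v x t + ?F *\<^sub>v s) $ j
        = - \<gamma> * \<omega> t $ j - (\<Sum>k<m. c j k * P t $ k) / inertia j + s $ j / inertia j"
      unfolding rhs[OF t] unfolding Minv using j s dims[OF t]
      by (simp add: mat_diag_mult_vec C_mult del: index_mult_mat_vec)
  qed (use j x in auto)
  have dP: "((\<lambda>\<tau>. P \<tau> $ k) has_real_derivative suscept k * (\<Sum>j<n. c j k * \<omega> t $ j))
      (at t within {0..})" if t: "t \<ge> 0" and k: "k < m" for t k
  proof (rule solves_lti_derivative[OF dynamics t, of "n + k"])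
    show "(?A *\<^sub>v x t + ?F *\<^sub>v s) $ (n + k) = suscept k * (\<Sum>j<n. c j k * \<omega> t $ j)"
      unfolding rhs[OF t] unfolding B using k s dims[OF t]
      by (simp add: Minv mat_diag_mult_vec Ct_mult del: index_mult_mat_vec)
  qed (use k x in auto)

  \<comment> \<open>Modal coordinates and projections\<close>
  define w where "w i j = v i $ j * sqrt (inertia j)" for i j
  \<comment> \<open>As vectors, \<open>w i\<close> is M^(1/2) v_i and \<open>g i\<close> is C^T
    M^(-1/2) v_i. Moving C to the other side of the scalar product, the sum in \<open>q\<close> is
    v_i . M^(-1/2) C P.\<close>
  define g where "g i k = (\<Sum>j<n. c j k * (v i $ j / sqrt (inertia j)))" for i k
  define y where "y i \<tau> = (\<Sum>j<n. w i j * \<omega> \<tau> $ j)" for i \<tau>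
  define q where "q i \<tau> = shat i - (\<Sum>k<m. g i k * P \<tau> $ k)" for i \<tau>

  \<comment> \<open>This is L v_i = lam_i v_i multiplied from the left by M^(1/2), namely C B C^T
    M^(-1/2) v_i = lam_i M^(1/2) v_i. The vector \<open>b\<close> below is B applied to
    \<open>g i\<close>.\<close>
  have eig: "(\<Sum>k<m. c j k * (suscept k * g i k)) = lam i * w i j" if i: "i < n" and j: "j < n" for i j
  proof -
    define a where "a = Minvsqrt *\<^sub>v v i"
    have a: "a = vec n (\<lambda>j. 1 / sqrt (inertia j) * v i $ j)"
      unfolding a_def Minvsqrt using i by (simp add: mat_diag_mult_vec)
    then have a_carr: "a \<in> carrier_vec n" by simp
    define b where "b = B *\<^sub>v (transpose_mat C *\<^sub>v a)"
    have b_carr: "b \<in> carrier_vec m"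
      by (simp add: b_def carrier_vecI)
    have b: "b $ k = suscept k * g i k" if "k < m" for k
    proof -
      have "b $ k = suscept k * (transpose_mat C *\<^sub>v a) $ k"
        unfolding b_def B using that by (subst mat_diag_mult_vec) simp_all
      also have "(transpose_mat C *\<^sub>v a) $ k = g i k"
        unfolding Ct_mult[OF a_carr that] by (simp add: g_def a)
      finally show ?thesis .
    qed
    have "lam i \<cdot>\<^sub>v v i = L *\<^sub>v v i"
      using eigen[OF i] by (simp add: eigenvector_def)
    also have "\<dots> = Minvsqrt *\<^sub>v (C *\<^sub>v b)"
      unfolding L b_def a_def using i
      by (simp add: carrier_matI carrier_vecI assoc_mult_mat_vec[of _ n n _ n] assoc_mult_mat_vec[of _ n m _ n]
          assoc_mult_mat_vec[of _ n m _ m] assoc_mult_mat_vec[of _ n n _ m])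
    also have "\<dots> = vec n (\<lambda>j. 1 / sqrt (inertia j) * (C *\<^sub>v b) $ j)"
      unfolding Minvsqrt by (intro mat_diag_mult_vec) simp
    finally have "(lam i \<cdot>\<^sub>v v i) $ j = (C *\<^sub>v b) $ j / sqrt (inertia j)"
      using j by simp
    moreover have "(C *\<^sub>v b) $ j = (\<Sum>k<m. c j k * (suscept k * g i k))"
      unfolding C_mult[OF b_carr j] by (simp add: b)
    ultimately show ?thesis
      using i j v[OF i] sqrt_pos[OF j] by (simp add: w_def field_simps)
  qed

  \<comment> \<open>The left side is v_i . M^(-1/2) s. Inserting the expansion of \<open>s\<close>
    cancels the square roots of the inertias, and orthonormality picks out one coefficient.\<close>
  have s_proj: "(\<Sum>j<n. w i j * (s $ j / inertia j)) = shat i" if i: "i < n" for i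
  proof -
    have s_j: "s $ j = (\<Sum>l<n. shat l * (sqrt (inertia j) * v l $ j))" if "j < n" for j
      unfolding s_expansion Msqrt using that by (simp add: mat_diag_mult_vec)
    have "(\<Sum>j<n. w i j * (s $ j / inertia j)) = (\<Sum>j<n. \<Sum>l<n. shat l * (v i $ j * v l $ j))"
    proof (rule sum.cong[OF refl], goal_cases)
      case (1 j)
      then have j: "j < n" by simp
      have "w i j * (s $ j / inertia j) = v i $ j * (s $ j / sqrt (inertia j))"
        using M_pos[OF j] by (simp add: w_def real_div_sqrt field_simps)
      also have "s $ j / sqrt (inertia j) = (\<Sum>l<n. shat l * v l $ j)"
        unfolding s_j[OF j] sum_divide_distrib using M_pos[OF j] by (intro sum.cong) auto
      finally show ?case
        by (simp add: sum_distrib_left mult_ac)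
    qed
    also have "\<dots> = (\<Sum>l<n. shat l * (v i \<bullet> v l))"
      by (subst sum.swap) (auto intro!: sum.cong simp: scalar_prod_def atLeast0LessThan sum_distrib_left)
    also have "\<dots> = shat i"
      using i by (simp add: orthonormal if_distrib cong: if_cong)
    finally show ?thesis .
  qed

  \<comment> \<open>The decoupled equations of each mode and their solution\<close>
  have y_sol: "of_real (y i t) = of_real (shat i) / r i *
      (exp (\<phi>p i * of_real t) - exp (\<phi>m i * of_real t))" if i: "i < n" for i
  proof -
    \<comment> \<open>Because M^(1/2) M^(-1) = M^(-1/2), the input contributes \<open>shat i\<close>
      and the flows contribute their product with \<open>g i\<close>; together these form
      \<open>q i\<close>.\<close>
    have dy: "(y i has_real_derivative - \<gamma> * y i t + q i t) (at t within {0..})" if t: "t \<ge> 0" for t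
    proof -
      have "(y i has_real_derivative (\<Sum>j<n. w i j *
          (- \<gamma> * \<omega> t $ j - (\<Sum>k<m. c j k * P t $ k) / inertia j + s $ j / inertia j)))
          (at t within {0..})"
        unfolding y_def using d\<omega>[OF t] by (intro DERIV_sum DERIV_cmult) auto
      also have "(\<Sum>j<n. w i j *
          (- \<gamma> * \<omega> t $ j - (\<Sum>k<m. c j k * P t $ k) / inertia j + s $ j / inertia j))
          = - \<gamma> * y i t - (\<Sum>j<n. w i j * ((\<Sum>k<m. c j k * P t $ k) / inertia j)) + shat i"
        by (simp add: distrib_left right_diff_distrib sum.distrib sum_subtractf s_proj[OF i, symmetric]
            y_def sum_distrib_left mult_ac sum_negf)
      also have "(\<Sum>j<n. w i j * ((\<Sum>k<m. c j k * P t $ k) / inertia j))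
          = (\<Sum>j<n. \<Sum>k<m. c j k * (v i $ j / sqrt (inertia j)) * P t $ k)"
      proof (rule sum.cong[OF refl], goal_cases)
        case (1 j)
        then have "w i j / inertia j = v i $ j / sqrt (inertia j)"
          using M_pos[of j] by (simp add: w_def real_div_sqrt field_simps)
        then have "w i j * ((\<Sum>k<m. c j k * P t $ k) / inertia j)
            = v i $ j / sqrt (inertia j) * (\<Sum>k<m. c j k * P t $ k)"
          by (metis times_divide_eq_left times_divide_eq_right)
        then show ?case
          by (simp add: sum_distrib_left mult_ac)
      qed
      also have "\<dots> = (\<Sum>k<m. g i k * P t $ k)"
        by (subst sum.swap) (simp add: g_def sum_distrib_right)
      finally show ?thesis by (simp add: q_def algebra_simps)
    qed
    \<comment> \<open>The input is constant in time, so only the flows contribute. Transposing turns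
      g_i . B C^T \<omega> into (C B g_i) . \<omega>, to which \<open>eig\<close> applies.\<close>
    have dq: "(q i has_real_derivative - lam i * y i t) (at t within {0..})" if t: "t \<ge> 0" for t
    proof -
      have "(q i has_real_derivative
          0 - (\<Sum>k<m. g i k * (suscept k * (\<Sum>j<n. c j k * \<omega> t $ j)))) (at t within {0..})"
        unfolding q_def using dP[OF t]
        by (intro DERIV_diff DERIV_sum DERIV_cmult DERIV_const) auto
      also have "(\<Sum>k<m. g i k * (suscept k * (\<Sum>j<n. c j k * \<omega> t $ j)))
          = (\<Sum>j<n. (\<Sum>k<m. c j k * (suscept k * g i k)) * \<omega> t $ j)"
        by (simp add: sum_distrib_left sum_distrib_right mult_ac)
           (rule sum.swap)
      also have "\<dots> = lam i * y i t"
        unfolding y_def sum_distrib_left by (intro sum.cong) (simp_all add: eig[OF i] mult.assoc)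
      finally show ?thesis by simp
    qed
    \<comment> \<open>Writing the zero state in two blocks lets the initial condition be compared
      blockwise. Vanishing initial flows make \<open>q i 0\<close> equal to \<open>shat i\<close>,
      the amplitude of the mode.\<close>
    have "0\<^sub>v n @\<^sub>v 0\<^sub>v m = (0\<^sub>v (n + m) :: real vec)"
      by (intro eq_vecI) auto
    then have "\<omega> 0 @\<^sub>v P 0 = 0\<^sub>v n @\<^sub>v 0\<^sub>v m"
      using x[of 0] initial by simp
    then have "\<omega> 0 = 0\<^sub>v n" "P 0 = 0\<^sub>v m"
      using append_vec_eq[of "\<omega> 0" n "0\<^sub>v n"] dims[of 0] by auto
    then have "y i 0 = 0" "q i 0 = shat i"
      by (simp_all add: y_def q_def)
    moreover have "r i \<noteq> 0"
      using root[OF i] nondegenerate[OF i] by (metis of_real_eq_0_iff zero_power2)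
    ultimately show ?thesis
      using damped_oscillator_response[OF dy dq _ root[OF i] _ t] by (simp add: \<phi>p \<phi>m i)
  qed

  \<comment> \<open>As a vector, the right side is M^(-1/2) (sum_i v_i v_i^T) M^(1/2) \<omega>, and
    the middle factor is the identity by \<open>orthonormal_complete\<close>.\<close>
  have \<omega>_expansion: "\<omega> t $ j = (\<Sum>i<n. y i t * (Minvsqrt *\<^sub>v v i) $ j)" if j: "j < n" for j
  proof -
    have "(\<Sum>i<n. y i t * (Minvsqrt *\<^sub>v v i) $ j)
        = (\<Sum>i<n. \<Sum>l<n. sqrt (inertia l) * \<omega> t $ l / sqrt (inertia j) * (v i $ l * v i $ j))"
      unfolding y_def w_def Minvsqrt using j
      by (intro sum.cong) (simp_all add: mat_diag_mult_vec sum_distrib_left sum_distrib_right sum_divide_distrib mult_ac)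
    also have "\<dots> = (\<Sum>l<n. sqrt (inertia l) * \<omega> t $ l / sqrt (inertia j) * (\<Sum>i<n. v i $ l * v i $ j))"
      by (subst sum.swap) (simp add: sum_distrib_left)
    also have "\<dots> = (\<Sum>l<n. if l = j then \<omega> t $ l else 0)"
      using sqrt_pos[OF j] j by (intro sum.cong) (auto simp: orthonormal_complete[OF v orthonormal])
    finally show ?thesis using j by simp
  qed
  show "map_vec complex_of_real (\<omega> t) =
    vec n (\<lambda>j. \<Sum>i<n. complex_of_real (shat i) / r i
                     * (exp (\<phi>p i * complex_of_real t) - exp (\<phi>m i * complex_of_real t))
                     * complex_of_real ((Minvsqrt *\<^sub>v v i) $ j))"
    using dims(1)[OF t] by (intro eq_vecI) (simp_all add: \<omega>_expansion y_sol)
qed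

end
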